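(* Let $\mathcal{C}\subset\mathbb{C}^3$ be an irreducible, non-planar real algebraic space curve defined by two polynomials $f_1,f_2\in\mathbb{R}[x_1,x_2,x_3]$, all of whose points at infinity are of the form $(1:m_2:m_3:0)$ with $m_2,m_3\in\mathbb{C}$. Assume that the $x_3$-axis is a valid projection direction for $\mathcal{C}$, and let $\mathcal{C}^p\subset\mathbb{C}^2$ be the plane curve obtained by projecting $\mathcal{C}$ along the $x_3$-axis. Then $B^p=\{(z,r_2(z))\in\mathbb{C}^2 : z\in\mathbb{C},\ |z|>M^p\}$ is an infinity branch of $\mathcal{C}^p$ for some $M^p\in\mathbb{R}^+$ if and only if there exists a series $r_3(z)=z\varphi_3(1/z)$, with $\varphi_3(z)\in\mathbb{C}\ll z\gg$, such that $B=\{(z,r_2(z),r_3(z))\in\mathbb{C}^3 : z\in\mathbb{C},\ |z|>M\}$ is an infinity branch of $\mathcal{C}$ for some $M\in\mathbb{R}^+$.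
   Context: A real algebraic curve here is a curve over $\mathbb{C}$ with infinitely many real points. $\mathbb{C}\ll t\gg=\bigcup_{n\ge1}\mathbb{C}((t^{1/n}))$ is the field of formal Puiseux series. Infinity branches of a space curve. Let $\mathcal{C}\subset\mathbb{C}^3$ be an algebraic curve, and let $\varphi_2(t),\varphi_3(t)\in\mathbb{C}\ll t\gg$ be Puiseux series without terms of negative exponent, $\varphi_k(t)=m_k+\sum_{i\ge1}a_{i,k}t^{N_{i,k}/N_k}$ with $a_{i,k}\neq0$ and $0<N_{1,k}<N_{2,k}<\cdots$, where $N_k$ is the ramification index (least common denominator of the exponents) of $\varphi_k$. Suppose they converge near $t=0$ and that, with $r_k(z)=z\varphi_k(z^{-1})=m_kz+\sum_{i\ge1}a_{i,k}z^{1-N_{i,k}/N_k}$, the points $(z,r_2(z),r_3(z))$ lie on $\mathcal{C}$ for $|z|>M$. Put $N=\operatorname{lcm}(N_2,N_3)$. The conjugates of $(r_2,r_3)$ are the $N$ pairs $(r_{j,2},r_{j,3})$, $r_{j,k}(z)=m_kz+\sum_{i\ge1}a_{i,k}c_j^{N_{i,k}N/N_k}z^{1-N_{i,k}/N_k}$, where $c_1,\dots,c_N$ are the complex $N$-th roots of $1$. The infinity branch associated with the infinity point $(1:m_2:m_3:0)$ is $B=\bigcup_{j=1}^N L_j$, with leaves $L_j=\{(z,r_{j,2}(z),r_{j,3}(z)) : |z|>M\}$. Since a branch is determined by one leaf up to conjugation, it is denoted by one leaf, $B=\{(z,r_2(z),r_3(z)) : |z|>M\}$. Infinity branches of a plane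 curve are defined in the same way with a single series: $B^p=\{(z,r_2(z)) : |z|>M^p\}$, $r_2(z)=z\varphi_2(z^{-1})$, where $\varphi_2$ is a Puiseux series without terms of negative exponent and the points $(z,r_2(z))$ lie on the plane curve for $|z|>M^p$ (again a branch is represented by one of its conjugate leaves). The $x_3$-axis is a valid projection direction if the projection $(x_1,x_2,x_3)\mapsto(x_1,x_2)$ restricts to a birational map from $\mathcal{C}$ to (the Zariski closure of) its image, the plane curve $\mathcal{C}^p$. Thus there is a rational function $h(x_1,x_2)=h_1(x_1,x_2)/h_2(x_1,x_2)$ (the lift function) such that the points of $\mathcal{C}$ are obtained from those of $\mathcal{C}^p$ by $x_3=h(x_1,x_2)$ (birational correspondence). *)

theory Defs
  imports
    "HOL-Analysis.Analysis"
    "HOL-Computational_Algebra.Formal_Laurent_Series"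
    "HOL-Library.Poly_Mapping"
    "HOL-Library.Extended_Nat"
begin

section \<open>Affine algebraic sets over the complex numbers\<close>

text \<open>
  Polynomials in variables indexed by the finite type \<open>'n\<close>: finitely supported maps from
  exponent vectors to coefficients.
\<close>

type_synonym 'n cpoly = "('n \<Rightarrow>\<^sub>0 nat) \<Rightarrow>\<^sub>0 complex"

definition monom_eval :: "('n::finite \<Rightarrow>\<^sub>0 nat) \<Rightarrow> complex ^ 'n \<Rightarrow> complex" where
  "monom_eval m x = (\<Prod>i\<in>UNIV. (x $ i) ^ Poly_Mapping.lookup m i)"

definition monom_deg :: "('n::finite \<Rightarrow>\<^sub>0 nat) \<Rightarrow> nat" where
  "monom_deg m = (\<Sum>i\<in>UNIV. Poly_Mapping.lookup m i)"

definition peval :: "'n::finite cpoly \<Rightarrow> complex ^ 'n \<Rightarrow> complex" where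
  "peval p x = (\<Sum>m\<in>Poly_Mapping.keys p. Poly_Mapping.lookup p m * monom_eval m x)"

definition total_deg :: "'n::finite cpoly \<Rightarrow> nat" where
  "total_deg p = Max (insert 0 (monom_deg ` Poly_Mapping.keys p))"

definition real_coeffs :: "'n cpoly \<Rightarrow> bool" where
  "real_coeffs p \<longleftrightarrow> (\<forall>m. Poly_Mapping.lookup p m \<in> \<real>)"

definition zero_set :: "'n::finite cpoly set \<Rightarrow> (complex ^ 'n) set" where
  "zero_set P = {x. \<forall>p\<in>P. peval p x = 0}"

definition zariski_closed :: "(complex ^ 'n::finite) set \<Rightarrow> bool" where
  "zariski_closed V \<longleftrightarrow> (\<exists>P. V = zero_set P)"

definition vanishing_ideal :: "(complex ^ 'n::finite) set \<Rightarrow> 'n cpoly set" where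
  "vanishing_ideal S = {p. \<forall>x\<in>S. peval p x = 0}"

definition zariski_closure :: "(complex ^ 'n::finite) set \<Rightarrow> (complex ^ 'n) set" where
  "zariski_closure S = zero_set (vanishing_ideal S)"

definition irreducible_variety :: "(complex ^ 'n::finite) set \<Rightarrow> bool" where
  "irreducible_variety V \<longleftrightarrow> zariski_closed V \<and> V \<noteq> {} \<and>
     (\<forall>A B. zariski_closed A \<longrightarrow> zariski_closed B \<longrightarrow> V = A \<union> B \<longrightarrow> V = A \<or> V = B)"

text \<open>Krull dimension: supremum of the lengths of chains of irreducible closed subsets.\<close>

definition zariski_dim :: "(complex ^ 'n::finite) set \<Rightarrow> enat" where
  "zariski_dim V = Sup {enat n | n. \<exists>Z :: nat \<Rightarrow> (complex ^ 'n) set.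
     (\<forall>i\<le>n. irreducible_variety (Z i) \<and> Z i \<subseteq> V) \<and> (\<forall>i<n. Z i \<subset> Z (Suc i))}"

definition real_points :: "(complex ^ 'n::finite) set \<Rightarrow> (complex ^ 'n) set" where
  "real_points V = {x \<in> V. \<forall>i. x $ i \<in> \<real>}"

definition planar :: "(complex ^ 3) set \<Rightarrow> bool" where
  "planar V \<longleftrightarrow> (\<exists>a b c d. (a, b, c) \<noteq> (0, 0, 0) \<and>
     V \<subseteq> {x. a * x $ 1 + b * x $ 2 + c * x $ 3 = d})"

section \<open>Points at infinity\<close>

text \<open>
  Homogeneous coordinates of a point of projective space are a pair \<open>(x, w)\<close>, where \<open>w\<close> is the
  homogenizing coordinate: \<open>(x, w)\<close> stands for \<open>(x\<^sub>1 : \<dots> : x\<^sub>n : w)\<close>.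
\<close>

definition homog_eval :: "'n::finite cpoly \<Rightarrow> complex ^ 'n \<Rightarrow> complex \<Rightarrow> complex" where
  "homog_eval p x w = (\<Sum>m\<in>Poly_Mapping.keys p.
     Poly_Mapping.lookup p m * monom_eval m x * w ^ (total_deg p - monom_deg m))"

definition projective_closure :: "(complex ^ 'n::finite) set \<Rightarrow> ((complex ^ 'n) \<times> complex) set" where
  "projective_closure V = {(x, w). (x, w) \<noteq> (0, 0) \<and>
     (\<forall>p\<in>vanishing_ideal V. homog_eval p x w = 0)}"

definition points_at_infinity :: "(complex ^ 'n::finite) set \<Rightarrow> (complex ^ 'n) set" where
  "points_at_infinity V = {x. (x, 0) \<in> projective_closure V}"

section \<open>Rational maps and birational projections\<close>

text \<open>
  A rational map with values in \<open>'m\<close>-space is given by its components, each a pair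
  (numerator, denominator); no denominator may vanish identically on the source \<open>X\<close>, which is
  meant to be irreducible.
\<close>

type_synonym ('n, 'm) ratmap = "'m \<Rightarrow> 'n cpoly \<times> 'n cpoly"

definition ratmap_dom :: "(complex ^ 'n::finite) set \<Rightarrow> ('n, 'm::finite) ratmap \<Rightarrow> (complex ^ 'n) set"
  where "ratmap_dom X R = {x \<in> X. \<forall>i. peval (snd (R i)) x \<noteq> 0}"

definition ratmap_app :: "('n::finite, 'm::finite) ratmap \<Rightarrow> complex ^ 'n \<Rightarrow> complex ^ 'm" where
  "ratmap_app R x = (\<chi> i. peval (fst (R i)) x / peval (snd (R i)) x)"

definition rational_map ::
  "(complex ^ 'n::finite) set \<Rightarrow> (complex ^ 'm::finite) set \<Rightarrow> ('n, 'm) ratmap \<Rightarrow> bool" where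
  "rational_map X Y R \<longleftrightarrow> (\<forall>i. \<exists>x\<in>X. peval (snd (R i)) x \<noteq> 0) \<and>
     (\<forall>x\<in>ratmap_dom X R. ratmap_app R x \<in> Y)"

text \<open>
  \<open>f\<close> is meant to be a polynomial map. It is birational from \<open>X\<close> to \<open>Y\<close> if it has an inverse
  rational map. Both composites are required to be defined somewhere, so that the
  identities, which hold wherever both sides are defined, are not vacuous.
\<close>

definition birational_from_to ::
  "(complex ^ 'n::finite \<Rightarrow> complex ^ 'm::finite) \<Rightarrow> (complex ^ 'n) set \<Rightarrow> (complex ^ 'm) set \<Rightarrow> bool"
  where
  "birational_from_to f X Y \<longleftrightarrow> f ` X \<subseteq> Y \<and>
     (\<exists>R. rational_map Y X R \<and>
        (\<exists>x\<in>X. f x \<in> ratmap_dom Y R) \<and>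
        (\<forall>x\<in>X. f x \<in> ratmap_dom Y R \<longrightarrow> ratmap_app R (f x) = x) \<and>
        (\<forall>y\<in>ratmap_dom Y R. f (ratmap_app R y) = y))"

definition proj12 :: "complex ^ 3 \<Rightarrow> complex ^ 2" where
  "proj12 x = vector [x $ 1, x $ 2]"

definition projected_curve :: "(complex ^ 3) set \<Rightarrow> (complex ^ 2) set" where
  "projected_curve C = zariski_closure (proj12 ` C)"

definition valid_projection_direction :: "(complex ^ 3) set \<Rightarrow> bool" where
  "valid_projection_direction C \<longleftrightarrow> birational_from_to proj12 C (projected_curve C)"

section \<open>Puiseux series and infinity branches\<close>

text \<open>
  A Puiseux series is represented by its coefficient function: \<open>\<phi> q\<close> is the coefficient of \<open>t\<close> to
  the power \<open>q\<close>. The function \<open>fls_root n F\<close> is the series \<open>F(t\<^bsup>1/n\<^esup>)\<close>.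
\<close>

definition fls_root :: "nat \<Rightarrow> complex fls \<Rightarrow> rat \<Rightarrow> complex" where
  "fls_root n F = (\<lambda>q. if q * of_nat n \<in> \<int> then fls_nth F \<lfloor>q * of_nat n\<rfloor> else 0)"

definition puiseux_series :: "(rat \<Rightarrow> complex) set" where
  "puiseux_series = (\<Union>n\<in>{1..}. range (fls_root n))"

definition no_negative_exponents :: "(rat \<Rightarrow> complex) \<Rightarrow> bool" where
  "no_negative_exponents \<phi> \<longleftrightarrow> (\<forall>q<0. \<phi> q = 0)"

definition ramification_index :: "(rat \<Rightarrow> complex) \<Rightarrow> nat" where
  "ramification_index \<phi> = (LEAST n. 0 < n \<and> (\<forall>q. \<phi> q \<noteq> 0 \<longrightarrow> q * of_nat n \<in> \<int>))"

text \<open>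
  The function \<open>r(z) = z \<phi>(1/z)\<close>, the sum of the terms \<open>\<phi> q z\<^bsup>1 - q\<^esup>\<close>, with the principal
  branch of all the fractional powers. The other choices of \<open>z\<^bsup>1/N\<^esup>\<close> are accounted for by
  the conjugates. Summability is absolute, and the power series in \<open>z\<^bsup>-1/N\<^esup>\<close> underlying \<open>\<phi>\<close>
  converges for all \<open>z\<close> of norm greater than \<open>M\<close> iff it converges absolutely for all of them.
\<close>

definition infinity_series :: "(rat \<Rightarrow> complex) \<Rightarrow> complex \<Rightarrow> complex" where
  "infinity_series \<phi> z = (\<Sum>\<^sub>\<infinity>q. \<phi> q * z powr (1 - of_rat q))"

definition converges_beyond :: "(rat \<Rightarrow> complex) \<Rightarrow> real \<Rightarrow> bool" where
  "converges_beyond \<phi> M \<longleftrightarrow>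
     (\<forall>z. norm z > M \<longrightarrow> (\<lambda>q. \<phi> q * z powr (1 - of_rat q)) summable_on UNIV)"

text \<open>
  With \<open>N\<close> a common denominator of the exponents and \<open>c\<close> an \<open>N\<close>-th root of unity, the term with
  exponent \<open>q\<close> is multiplied by \<open>c\<^bsup>q N\<^esup>\<close>; if \<open>q = N\<^sub>i/N\<^sub>k\<close> then \<open>q N = N\<^sub>i N/N\<^sub>k\<close>.
\<close>

definition conjugate_series :: "nat \<Rightarrow> complex \<Rightarrow> (rat \<Rightarrow> complex) \<Rightarrow> rat \<Rightarrow> complex" where
  "conjugate_series N c \<phi> = (\<lambda>q. \<phi> q * c powi \<lfloor>q * of_nat N\<rfloor>)"

definition plane_leaf :: "(rat \<Rightarrow> complex) \<Rightarrow> real \<Rightarrow> (complex ^ 2) set" where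
  "plane_leaf \<phi>2 M = {vector [z, infinity_series \<phi>2 z] | z. norm z > M}"

definition space_leaf :: "(rat \<Rightarrow> complex) \<Rightarrow> (rat \<Rightarrow> complex) \<Rightarrow> real \<Rightarrow> (complex ^ 3) set" where
  "space_leaf \<phi>2 \<phi>3 M =
     {vector [z, infinity_series \<phi>2 z, infinity_series \<phi>3 z] | z. norm z > M}"

definition plane_branch :: "(rat \<Rightarrow> complex) \<Rightarrow> real \<Rightarrow> (complex ^ 2) set" where
  "plane_branch \<phi>2 M =
     (let N = ramification_index \<phi>2
      in \<Union>c\<in>{c. c ^ N = 1}. plane_leaf (conjugate_series N c \<phi>2) M)"

definition space_branch :: "(rat \<Rightarrow> complex) \<Rightarrow> (rat \<Rightarrow> complex) \<Rightarrow> real \<Rightarrow> (complex ^ 3) set" where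
  "space_branch \<phi>2 \<phi>3 M =
     (let N = lcm (ramification_index \<phi>2) (ramification_index \<phi>3)
      in \<Union>c\<in>{c. c ^ N = 1}.
           space_leaf (conjugate_series N c \<phi>2) (conjugate_series N c \<phi>3) M)"

definition admissible_series :: "(rat \<Rightarrow> complex) \<Rightarrow> real \<Rightarrow> bool" where
  "admissible_series \<phi> M \<longleftrightarrow>
     \<phi> \<in> puiseux_series \<and> no_negative_exponents \<phi> \<and> converges_beyond \<phi> M"

text \<open>
  \<open>B\<close> is the infinity branch of the curve denoted by the leaf \<open>(z, r\<^sub>2(z))\<close> (respectively
  \<open>(z, r\<^sub>2(z), r\<^sub>3(z))\<close>), \<open>|z| > M\<close>. The infinity point of the branch is
  \<open>(1 : \<phi>2 0 : 0)\<close> (respectively \<open>(1 : \<phi>2 0 : \<phi>3 0 : 0)\<close>).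
\<close>

definition plane_infinity_branch ::
  "(complex ^ 2) set \<Rightarrow> (complex ^ 2) set \<Rightarrow> (rat \<Rightarrow> complex) \<Rightarrow> real \<Rightarrow> bool" where
  "plane_infinity_branch C B \<phi>2 M \<longleftrightarrow>
     admissible_series \<phi>2 M \<and> plane_leaf \<phi>2 M \<subseteq> C \<and> B = plane_branch \<phi>2 M"

definition space_infinity_branch ::
  "(complex ^ 3) set \<Rightarrow> (complex ^ 3) set \<Rightarrow> (rat \<Rightarrow> complex) \<Rightarrow> (rat \<Rightarrow> complex) \<Rightarrow> real \<Rightarrow> bool" where
  "space_infinity_branch C B \<phi>2 \<phi>3 M \<longleftrightarrow>
     admissible_series \<phi>2 M \<and> admissible_series \<phi>3 M \<and>
     space_leaf \<phi>2 \<phi>3 M \<subseteq> C \<and> B = space_branch \<phi>2 \<phi>3 M"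

end

theory Submission
  imports Defs "HOL-Complex_Analysis.Complex_Analysis"
begin

text \<open>
  Projecting a branch of \<open>C\<close> is immediate. For the converse, the projected curve is cut out in the
  plane by a nonzero prime ideal, for otherwise the rational inverse of the projection would lift a
  line to a proper irreducible subcurve of \<open>C\<close>. No polynomial outside this ideal vanishes along the
  plane leaf, so the denominator of the lift function \<open>h\<close> is a nonzero Laurent series there and
  \<open>r\<^sub>3(z) = h(z, r\<^sub>2(z))\<close> is a convergent Laurent series in \<open>z\<^bsup>-1/n\<^esup>\<close>. It grows at most
  linearly because \<open>(0:0:1:0)\<close> is not a point at infinity of \<open>C\<close>.
\<close>

(* The dollar sign would otherwise also denote the coefficients of formal power series. *)
unbundle no Formal_Power_Series.fps_syntax

section \<open>Polynomial functions\<close>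

lemma peval_superset:
  assumes "finite S" "Poly_Mapping.keys p \<subseteq> S"
  shows "peval p x = (\<Sum>m\<in>S. Poly_Mapping.lookup p m * monom_eval m x)"
  unfolding peval_def using assms
  by (intro sum.mono_neutral_left) (auto simp: in_keys_iff)

lemma peval_add: "peval (p + q) x = peval p x + peval q x"
proof -
  let ?S = "Poly_Mapping.keys p \<union> Poly_Mapping.keys q"
  have "peval (p + q) x = (\<Sum>m\<in>?S. Poly_Mapping.lookup (p + q) m * monom_eval m x)"
    using Poly_Mapping.keys_add[of p q] by (intro peval_superset) auto
  also have "\<dots> = peval p x + peval q x"
    by (simp add: peval_superset[of ?S p] peval_superset[of ?S q] lookup_add algebra_simps sum.distrib)
  finally show ?thesis .
qed

lemma peval_zero [simp]: "peval 0 x = 0"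
  by (simp add: peval_def)

lemma peval_sum: "peval (sum f A) x = (\<Sum>a\<in>A. peval (f a) x)"
  by (induction A rule: infinite_finite_induct) (auto simp: peval_add)

lemma peval_single: "peval (Poly_Mapping.single m c) x = c * monom_eval m x"
  by (subst peval_superset[of "{m}"]) auto

lemma peval_mult: "peval (p * q) x = peval p x * peval q x"
proof -
  have decomp: "r = (\<Sum>m\<in>Poly_Mapping.keys r. Poly_Mapping.single m (Poly_Mapping.lookup r m))"
    for r :: "'a cpoly"
    by (rule poly_mapping_eqI) (simp add: lookup_sum lookup_single when_def in_keys_iff)
  have monom: "monom_eval (m + m') x = monom_eval m x * monom_eval m' x" for m m'
    by (simp add: monom_eval_def lookup_add power_add prod.distrib)
  have pq: "p * q = (\<Sum>m\<in>Poly_Mapping.keys p. \<Sum>m'\<in>Poly_Mapping.keys q.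
      Poly_Mapping.single (m + m') (Poly_Mapping.lookup p m * Poly_Mapping.lookup q m'))"
    by (subst decomp[of p], subst decomp[of q]) (simp add: sum_product mult_single)
  show ?thesis
    unfolding pq
    by (simp add: peval_sum peval_single monom peval_def[of p] peval_def[of q] sum_product mult_ac)
qed

lemma peval_const: "peval (Poly_Mapping.single 0 c) x = c"
  by (simp add: peval_single monom_eval_def)

lemma peval_coord: "peval (Poly_Mapping.single (Poly_Mapping.single i 1) 1) x = x $ i"
  by (simp add: peval_single monom_eval_def lookup_single when_def power_0 if_distrib
      [where f = "\<lambda>k. _ ^ k"] cong: if_cong)

text \<open>The coordinates generate all polynomial functions. The predicate is on functions rather
  than on coefficient maps, so that holomorphy or Laurent expandability need only be checked for
  four constructions.\<close>

lemma peval_induct [case_names const coord add mult]: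
  fixes p :: "'n::finite cpoly"
  assumes const: "\<And>c. Q (\<lambda>x. c)"
    and coord: "\<And>i. Q (\<lambda>x. x $ i)"
    and add: "\<And>f g. Q f \<Longrightarrow> Q g \<Longrightarrow> Q (\<lambda>x. f x + g x)"
    and mult: "\<And>f g. Q f \<Longrightarrow> Q g \<Longrightarrow> Q (\<lambda>x. f x * g x)"
  shows "Q (peval p)"
proof -
  have power: "Q (\<lambda>x. x $ i ^ k)" for i k
    by (induction k) (auto intro: const coord mult)
  have prod: "Q (\<lambda>x. \<Prod>i\<in>A. f i x)" if "finite A" "\<And>i. Q (f i)" for A and f :: "'n \<Rightarrow> _"
    using that by (induction A rule: finite_induct) (auto intro: const mult)
  have sum: "Q (\<lambda>x. \<Sum>m\<in>A. f m x)" if "finite A" "\<And>m. Q (f m)"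
    for A and f :: "('n \<Rightarrow>\<^sub>0 nat) \<Rightarrow> _"
    using that by (induction A rule: finite_induct) (auto intro: const add)
  show ?thesis
    unfolding peval_def[abs_def] monom_eval_def
    by (intro sum mult const prod power) auto
qed

text \<open>Lets polynomials be written as plain functions, without exhibiting a finitely supported
  coefficient map.\<close>

definition polyfun :: "(complex ^ 'n::finite \<Rightarrow> complex) \<Rightarrow> bool" where
  "polyfun f \<longleftrightarrow> (\<exists>p. \<forall>x. peval p x = f x)"

lemma polyfun_const [intro]: "polyfun (\<lambda>x. c)"
  unfolding polyfun_def using peval_const by blast

lemma polyfun_coord [intro]: "polyfun (\<lambda>x. x $ i)"
  unfolding polyfun_def using peval_coord by blast

lemma polyfun_add [intro]: "polyfun f \<Longrightarrow> polyfun g \<Longrightarrow> polyfun (\<lambda>x. f x + g x)"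
  unfolding polyfun_def by (metis peval_add)

lemma polyfun_mult [intro]: "polyfun f \<Longrightarrow> polyfun g \<Longrightarrow> polyfun (\<lambda>x. f x * g x)"
  unfolding polyfun_def by (metis peval_mult)

section \<open>Zariski closed sets\<close>

lemma zariski_closedI_polyfun:
  assumes "zariski_closed V" "polyfun f"
  shows "zariski_closed {x \<in> V. f x = 0}"
proof -
  obtain P p where "V = zero_set P" "\<forall>x. peval p x = f x"
    using assms by (auto simp: zariski_closed_def polyfun_def)
  then have "{x \<in> V. f x = 0} = zero_set (insert p P)"
    by (auto simp: zero_set_def)
  then show ?thesis
    by (auto simp: zariski_closed_def)
qed

text \<open>The zero sets of \<open>f\<close> and \<open>g\<close> in \<open>V\<close> are closed
  and cover \<open>V\<close>, so one of them is all of \<open>V\<close>.\<close>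

lemma irreducible_variety_prime:
  assumes V: "irreducible_variety V" and "polyfun f" "polyfun g"
    and prod: "\<And>x. x \<in> V \<Longrightarrow> f x * g x = 0"
  shows "(\<forall>x\<in>V. f x = 0) \<or> (\<forall>x\<in>V. g x = 0)"
proof -
  have "zariski_closed V"
    using V by (simp add: irreducible_variety_def)
  then have "zariski_closed {x \<in> V. f x = 0}" "zariski_closed {x \<in> V. g x = 0}"
    using assms(2,3) by (auto intro: zariski_closedI_polyfun)
  moreover have "V = {x \<in> V. f x = 0} \<union> {x \<in> V. g x = 0}"
    using prod by auto
  ultimately have "V = {x \<in> V. f x = 0} \<or> V = {x \<in> V. g x = 0}"
    using V unfolding irreducible_variety_def by blast
  then show ?thesis
    by blast
qed

section \<open>Zariski closures and chains of irreducible sets\<close>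

lemma zariski_closed_closure: "zariski_closed (zariski_closure S)"
  by (auto simp: zariski_closed_def zariski_closure_def)

lemma subset_zariski_closure: "S \<subseteq> zariski_closure S"
  by (auto simp: zariski_closure_def zero_set_def vanishing_ideal_def)

lemma zariski_closure_minimal:
  assumes "S \<subseteq> V" "zariski_closed V"
  shows "zariski_closure S \<subseteq> V"
  using assms by (force simp: zariski_closed_def zariski_closure_def zero_set_def vanishing_ideal_def)

text \<open>If \<open>S\<close> lay in neither of two closed sets covering its closure, an equation
  of each would be nonzero somewhere on \<open>S\<close>, while their product vanishes on
  \<open>S\<close>. Primeness is asked on \<open>S\<close> alone, so it can be tested on a
  parametrization.\<close>

lemma irreducible_zariski_closure:
  assumes "S \<noteq> {}"
    and prime: "\<And>p q. (\<And>x. x \<in> S \<Longrightarrow> peval p x * peval q x = 0) \<Longrightarrow>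
      (\<forall>x\<in>S. peval p x = 0) \<or> (\<forall>x\<in>S. peval q x = 0)"
  shows "irreducible_variety (zariski_closure S)"
  unfolding irreducible_variety_def
proof (intro conjI allI impI)
  show "zariski_closed (zariski_closure S)"
    by (rule zariski_closed_closure)
  show "zariski_closure S \<noteq> {}"
    using assms(1) subset_zariski_closure by blast
next
  fix A B assume AB: "zariski_closed A" "zariski_closed B" "zariski_closure S = A \<union> B"
  then obtain P Q where PQ: "A = zero_set P" "B = zero_set Q"
    by (auto simp: zariski_closed_def)
  have "S \<subseteq> A \<or> S \<subseteq> B"
  proof (rule ccontr)
    assume "\<not> (S \<subseteq> A \<or> S \<subseteq> B)"
    then obtain a b p q where *: "a \<in> S" "p \<in> P" "peval p a \<noteq> 0" "b \<in> S" "q \<in> Q" "peval q b \<noteq> 0"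
      unfolding PQ zero_set_def by blast
    have "peval p x * peval q x = 0" if "x \<in> S" for x
      using that subset_zariski_closure[of S] * unfolding AB(3) PQ zero_set_def by auto
    from prime[OF this] * show False
      by blast
  qed
  then show "zariski_closure S = A \<or> zariski_closure S = B"
    using AB zariski_closure_minimal by blast
qed

lemma irreducible_variety_singleton: "irreducible_variety {a}"
proof -
  have "zariski_closure {a} \<subseteq> {a}"
  proof
    fix x assume x: "x \<in> zariski_closure {a}"
    have "x $ i = a $ i" for i
    proof -
      have "polyfun (\<lambda>y. y $ i + (- a $ i))"
        by (intro polyfun_add polyfun_coord polyfun_const)
      then obtain p where p: "\<And>y. peval p y = y $ i + (- a $ i)"
        by (auto simp: polyfun_def)
      then have "peval p a = 0"
        by simp
      then have "peval p x = 0"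
        using x by (auto simp: zariski_closure_def zero_set_def vanishing_ideal_def)
      then show ?thesis
        by (simp add: p)
    qed
    then show "x \<in> {a}"
      by (simp add: vec_eq_iff)
  qed
  then have "zariski_closure {a} = {a}"
    using subset_zariski_closure by blast
  moreover have "irreducible_variety (zariski_closure {a})"
    by (rule irreducible_zariski_closure) auto
  ultimately show ?thesis
    by simp
qed

lemma zariski_dim_ge_2:
  assumes "irreducible_variety X" "irreducible_variety Y" "irreducible_variety Z" "X \<subset> Y" "Y \<subset> Z"
  shows "zariski_dim Z \<ge> 2"
proof -
  define W where "W i = (if i = 0 then X else if i = 1 then Y else Z)" for i :: nat
  have "(\<forall>i\<le>2. irreducible_variety (W i) \<and> W i \<subseteq> Z) \<and> (\<forall>i<2. W i \<subset> W (Suc i))"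
    using assms by (auto simp: W_def less_Suc_eq numeral_2_eq_2)
  then have "enat 2 \<le> zariski_dim Z"
    unfolding zariski_dim_def by (intro Sup_upper) blast
  then show ?thesis
    by (simp add: numeral_eq_enat)
qed

section \<open>Points at infinity\<close>

lemma homog_eval_scale:
  assumes "s \<noteq> 0"
  shows "homog_eval p (s *s x) s = s ^ total_deg p * peval p x"
proof -
  have "monom_eval m (s *s x) * s ^ (total_deg p - monom_deg m) = s ^ total_deg p * monom_eval m x"
    if "m \<in> Poly_Mapping.keys p" for m
  proof -
    have "monom_deg m \<le> total_deg p"
      using that by (auto simp: total_deg_def)
    moreover have "monom_eval m (s *s x) = s ^ monom_deg m * monom_eval m x"
      by (simp add: monom_eval_def monom_deg_def power_mult_distrib prod.distrib power_sum)
    ultimately show ?thesis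
      by (simp add: power_add[symmetric] mult_ac)
  qed
  then show ?thesis
    by (simp add: homog_eval_def peval_def sum_distrib_left mult_ac)
qed

lemma tendsto_homog_eval:
  assumes "(x \<longlongrightarrow> v) F" "(s \<longlongrightarrow> t) F"
  shows "((\<lambda>a. homog_eval p (x a) (s a)) \<longlongrightarrow> homog_eval p v t) F"
  unfolding homog_eval_def monom_eval_def
  by (intro tendsto_intros assms)

text \<open>Homogenized equations of \<open>V\<close> vanish at the homogeneous coordinates
  \<open>(s x, s)\<close> of its affine points, and by continuity also at the limit, where the
  homogenizing coordinate is 0.\<close>

lemma points_at_infinityI:
  assumes "F \<noteq> bot" "((\<lambda>a. s a *s x a) \<longlongrightarrow> v) F" "(s \<longlongrightarrow> 0) F"
    and ev: "eventually (\<lambda>a. s a \<noteq> 0 \<and> x a \<in> V) F" and "v \<noteq> 0"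
  shows "v \<in> points_at_infinity V"
proof -
  have "homog_eval p v 0 = 0" if "p \<in> vanishing_ideal V" for p
  proof (rule tendsto_unique[OF assms(1) tendsto_homog_eval[OF assms(2,3)]])
    have "eventually (\<lambda>a. homog_eval p (s a *s x a) (s a) = 0) F"
      using ev by eventually_elim (use that in \<open>simp add: homog_eval_scale vanishing_ideal_def\<close>)
    then show "((\<lambda>a. homog_eval p (s a *s x a) (s a)) \<longlongrightarrow> 0) F"
      by (rule tendsto_eventually)
  qed
  then show ?thesis
    using assms(5) by (simp add: points_at_infinity_def projective_closure_def)
qed

section \<open>The ideal of the projected curve\<close>

text \<open>After inverting the nonzero constants, polynomials in one variable form a principal
  ideal domain, where a nonzero prime ideal is maximal; \<open>I\<close> stays proper there because
  it contains no nonzero constant. Pseudo-division carries this out without fractions.\<close>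

lemma prime_ideal_maximal_over_constants:
  fixes I J :: "'a::idom poly set"
  assumes "J \<subseteq> I" and nonzero: "\<exists>q\<in>J. q \<noteq> 0"
    and J_mult: "\<And>f g. f \<in> J \<Longrightarrow> f * g \<in> J"
    and J_prime: "\<And>f g. f * g \<in> J \<Longrightarrow> f \<in> J \<or> g \<in> J"
    and I_mult: "\<And>f g. f \<in> I \<Longrightarrow> f * g \<in> I"
    and I_diff: "\<And>f g. f \<in> I \<Longrightarrow> g \<in> I \<Longrightarrow> f - g \<in> I"
    and I_const: "\<And>a. [:a:] \<in> I \<Longrightarrow> a = 0"
  shows "I \<subseteq> J"
proof (rule ccontr)
  assume "\<not> I \<subseteq> J"
  then obtain d where d: "d \<in> I" "d \<notin> J"
    by blast
  obtain q where q: "q \<in> J" "q \<noteq> 0" and q_min: "\<And>f. f \<in> J \<Longrightarrow> f \<noteq> 0 \<Longrightarrow> degree q \<le> degree f"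
    using ex_has_least_nat[of "\<lambda>f. f \<in> J \<and> f \<noteq> 0" _ degree] nonzero by blast
  \<comment> \<open>Minimality of the degree makes \<open>g\<close> a generator of \<open>I\<close>
    up to constant factors.\<close>
  obtain g where g: "g \<in> I" "g \<noteq> 0" and g_min: "\<And>f. f \<in> I \<Longrightarrow> f \<noteq> 0 \<Longrightarrow> degree g \<le> degree f"
    using ex_has_least_nat[of "\<lambda>f. f \<in> I \<and> f \<noteq> 0" q degree] q assms(1) by blast
  have "degree g \<noteq> 0"
    using g I_const by (metis degree_0_id pCons_0_0)
  have divides: "\<exists>a s. a \<noteq> 0 \<and> smult a f = g * s" if "f \<in> I" for f
  proof -
    obtain a s where as: "a \<noteq> 0" "smult a f = g * s + pseudo_mod f g"
      using pseudo_mod(1)[OF g(2)] by blast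
    have "pseudo_mod f g = f * [:a:] - g * s"
      using as(2) by (simp add: algebra_simps)
    then have "pseudo_mod f g \<in> I"
      using I_diff[OF I_mult[OF that, of "[:a:]"] I_mult[OF g(1), of s]] by simp
    then have "pseudo_mod f g = 0"
      using pseudo_mod(2)[OF g(2), of f] g_min by fastforce
    then show ?thesis
      using as by auto
  qed
  obtain a s where as: "a \<noteq> 0" "smult a q = g * s"
    using divides q(1) assms(1) by blast
  have "g * s \<in> J"
    using J_mult[OF q(1), of "[:a:]"] as(2) by simp
  \<comment> \<open>If \<open>g\<close> is in \<open>J\<close>, so is a constant multiple of
    \<open>d\<close>, and primeness puts a nonzero constant into \<open>I\<close>. If
    \<open>s\<close> is in \<open>J\<close>, its degree undercuts that of \<open>q\<close>.\<close>
  then consider "g \<in> J" | "s \<in> J"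
    using J_prime by blast
  then show False
  proof cases
    case 1
    obtain b t where bt: "b \<noteq> 0" "smult b d = g * t"
      using divides d(1) by blast
    have "d * [:b:] \<in> J"
      using J_mult[OF 1, of t] bt(2) by simp
    then have "[:b:] \<in> I"
      using J_prime d(2) assms(1) by blast
    then show False
      using I_const bt(1) by blast
  next
    case 2
    have "s \<noteq> 0"
      using as q(2) by auto
    then have "degree q = degree g + degree s"
      using as g(2) by (metis degree_mult_eq degree_smult_eq)
    then show False
      using q_min[OF 2 \<open>s \<noteq> 0\<close>] \<open>degree g \<noteq> 0\<close> by simp
  qed
qed

text \<open>If \<open>f\<close> is not identically zero, \<open>g\<close> vanishes on the nonempty
  open set where \<open>f\<close> does not, hence on all of \<open>T\<close> by the identity
  theorem.\<close>

lemma holomorphic_mult_eq_0: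
  assumes "f holomorphic_on T" "g holomorphic_on T" "open T" "connected T"
    and prod: "\<And>z. z \<in> T \<Longrightarrow> f z * g z = 0"
  shows "(\<forall>z\<in>T. f z = 0) \<or> (\<forall>z\<in>T. g z = 0)"
proof (rule ccontr)
  assume "\<not> ?thesis"
  then obtain a b where ab: "a \<in> T" "f a \<noteq> 0" "b \<in> T" "g b \<noteq> 0"
    by blast
  define U where "U = {z \<in> T. f z \<noteq> 0}"
  have "open (T \<inter> f -` (- {0}))"
    using assms by (intro continuous_open_preimage holomorphic_on_imp_continuous_on) auto
  moreover have "T \<inter> f -` (- {0}) = U"
    by (auto simp: U_def)
  ultimately have "open U"
    by simp
  have "g b = 0"
    by (rule analytic_continuation_open[of U T g "\<lambda>_. 0"])
      (use assms ab \<open>open U\<close> in \<open>auto simp: U_def\<close>)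
  then show False
    using ab by simp
qed

text \<open>The outer variable is the second coordinate and the coefficients are polynomials in the
  first, so the constants of \<open>prime_ideal_maximal_over_constants\<close> become the
  polynomials in the first coordinate alone.\<close>

abbreviation eval2 :: "complex poly poly \<Rightarrow> complex \<Rightarrow> complex \<Rightarrow> complex" where
  "eval2 P a b \<equiv> poly (poly P [:b:]) a"

lemma peval_eq_eval2: "\<exists>P. \<forall>a b. peval p (vector [a, b] :: complex ^ 2) = eval2 P a b"
proof -
  have "\<exists>P. \<forall>a b. f (vector [a, b] :: complex ^ 2) = eval2 P a b" if "f = peval p" for f
    unfolding that
  proof (induction p rule: peval_induct)
    case (const c)
    show ?case
      by (rule exI[of _ "[:[:c:]:]"]) simp
  next
    case (coord i)
    consider "i = 1" | "i = 2"
      by (meson exhaust_2)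
    then show ?case
    proof cases
      case 1
      then show ?thesis
        by (intro exI[of _ "[:[:0, 1:]:]"]) simp
    next
      case 2
      then show ?thesis
        by (intro exI[of _ "[:0, 1:]"]) simp
    qed
  next
    case (add f g)
    then obtain P Q where "\<forall>a b. f (vector [a, b]) = eval2 P a b" "\<forall>a b. g (vector [a, b]) = eval2 Q a b"
      by blast
    then show ?case
      by (intro exI[of _ "P + Q"]) simp
  next
    case (mult f g)
    then obtain P Q where "\<forall>a b. f (vector [a, b]) = eval2 P a b" "\<forall>a b. g (vector [a, b]) = eval2 Q a b"
      by blast
    then show ?case
      by (intro exI[of _ "P * Q"]) simp
  qed
  then show ?thesis
    by blast
qed

lemma polyfun_eval2:
  assumes "polyfun f" "polyfun g"
  shows "polyfun (\<lambda>x. eval2 P (f x) (g x))"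
proof (induction P)
  case 0
  then show ?case
    by (simp add: polyfun_const)
next
  case (pCons r P)
  have "polyfun (\<lambda>x. poly r (f x))"
    by (induction r) (auto simp: polyfun_const intro!: polyfun_add polyfun_mult assms)
  then show ?case
    using pCons assms by (auto intro!: polyfun_add polyfun_mult)
qed

text \<open>The ideal of the projected curve, but tested on \<open>C\<close> itself, so that
  primeness is inherited directly from the irreducibility of \<open>C\<close>.\<close>

definition proj_ideal :: "(complex ^ 3) set \<Rightarrow> complex poly poly set" where
  "proj_ideal C = {P. \<forall>x\<in>C. eval2 P (x $ 1) (x $ 2) = 0}"

lemma proj_ideal_prime:
  assumes "irreducible_variety C" "P * Q \<in> proj_ideal C"
  shows "P \<in> proj_ideal C \<or> Q \<in> proj_ideal C"
proof -
  have "polyfun (\<lambda>x :: complex ^ 3. eval2 R (x $ 1) (x $ 2))" for R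
    by (intro polyfun_eval2 polyfun_coord)
  from irreducible_variety_prime[OF assms(1) this[of P] this[of Q]] show ?thesis
    using assms(2) by (auto simp: proj_ideal_def)
qed

lemma vector_2_eta: "(vector [y $ 1, y $ 2] :: 'a::zero ^ 2) = y"
  by (simp add: vec_eq_iff forall_2)

lemma proj_ideal_projected_curve:
  assumes "P \<in> proj_ideal C" "y \<in> projected_curve C"
  shows "eval2 P (y $ 1) (y $ 2) = 0"
proof -
  have "polyfun (\<lambda>y :: complex ^ 2. eval2 P (y $ 1) (y $ 2))"
    by (intro polyfun_eval2 polyfun_coord)
  then obtain p where p: "\<And>y :: complex ^ 2. peval p y = eval2 P (y $ 1) (y $ 2)"
    by (auto simp: polyfun_def)
  then have "p \<in> vanishing_ideal (proj12 ` C)"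
    using assms(1) by (auto simp: vanishing_ideal_def proj_ideal_def proj12_def)
  then show ?thesis
    using assms(2) p by (auto simp: projected_curve_def zariski_closure_def zero_set_def)
qed

lemma projected_curve_eq_UNIV:
  assumes "proj_ideal C \<subseteq> {0}"
  shows "projected_curve C = UNIV"
proof -
  have "peval p y = 0" if p: "p \<in> vanishing_ideal (proj12 ` C)" for p y
  proof -
    obtain P where P: "\<And>a b. peval p (vector [a, b]) = eval2 P a b"
      using peval_eq_eval2 by blast
    have "P \<in> proj_ideal C"
      using p by (auto simp: proj_ideal_def vanishing_ideal_def proj12_def P[symmetric])
    then have "P = 0"
      using assms by blast
    then show ?thesis
      using P[of "y $ 1" "y $ 2"] by (simp add: vector_2_eta)
  qed
  then show ?thesis
    by (auto simp: projected_curve_def zariski_closure_def zero_set_def)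
qed

text \<open>Unpacks the rational inverse: its third component is the lift function, and its first
  two are forced by the projection. The point \<open>x\<close> witnesses that \<open>D\<close> does
  not vanish identically on the projected curve.\<close>

lemma valid_projection_lift:
  assumes "valid_projection_direction C"
  obtains D h1 h2 :: "2 cpoly" and x where
    "x \<in> C" "peval D (proj12 x) \<noteq> 0"
    "\<And>y. peval D y \<noteq> 0 \<Longrightarrow> peval h2 y \<noteq> 0"
    "\<And>y. y \<in> projected_curve C \<Longrightarrow> peval D y \<noteq> 0 \<Longrightarrow>
      vector [y $ 1, y $ 2, peval h1 y / peval h2 y] \<in> C"
proof -
  obtain R where R: "rational_map (projected_curve C) C R"
    and ex: "\<exists>x\<in>C. proj12 x \<in> ratmap_dom (projected_curve C) R"
    and inv: "\<forall>y\<in>ratmap_dom (projected_curve C) R. proj12 (ratmap_app R y) = y"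
    using assms unfolding valid_projection_direction_def birational_from_to_def by blast
  \<comment> \<open>The nonvanishing of this one polynomial says that all three components of the
    inverse are defined.\<close>
  define D where "D = snd (R 1) * snd (R 2) * snd (R 3)"
  have D: "peval D y \<noteq> 0 \<longleftrightarrow> (\<forall>i. peval (snd (R i)) y \<noteq> 0)" for y
    by (simp add: D_def peval_mult forall_3)
  obtain x where x: "x \<in> C" "proj12 x \<in> ratmap_dom (projected_curve C) R"
    using ex by blast
  show thesis
  proof (rule that)
    show "x \<in> C" "peval D (proj12 x) \<noteq> 0"
      using x by (auto simp: D ratmap_dom_def)
    show "peval (snd (R 3)) y \<noteq> 0" if "peval D y \<noteq> 0" for y
      using that by (simp add: D)
  next
    fix y assume y: "y \<in> projected_curve C" "peval D y \<noteq> 0"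
    then have dom: "y \<in> ratmap_dom (projected_curve C) R"
      by (simp add: D ratmap_dom_def)
    then have "ratmap_app R y \<in> C"
      using R by (simp add: rational_map_def)
    moreover have "proj12 (ratmap_app R y) = y"
      using inv dom by blast
    then have "ratmap_app R y = vector [y $ 1, y $ 2, peval (fst (R 3)) y / peval (snd (R 3)) y]"
      by (auto simp: vec_eq_iff forall_2 forall_3 proj12_def) (simp add: ratmap_app_def)
    ultimately show "vector [y $ 1, y $ 2, peval (fst (R 3)) y / peval (snd (R 3)) y] \<in> C"
      by simp
  qed
qed

text \<open>
  If the projection were dominant, the inverse map would be defined on almost all of some line
  \<open>x\<^sub>1 = c\<close>. The lift of that line is a rational curve, so \<open>C\<close> would contain a chain consisting
  of a point, this curve, and \<open>C\<close> itself.
\<close>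

lemma proj_ideal_nonzero:
  assumes irr: "irreducible_variety C" and dim: "zariski_dim C = 1" and "\<not> planar C"
    and val: "valid_projection_direction C"
  shows "\<exists>P\<in>proj_ideal C. P \<noteq> 0"
proof (rule ccontr)
  assume "\<not> (\<exists>P\<in>proj_ideal C. P \<noteq> 0)"
  then have UNIV: "projected_curve C = UNIV"
    by (intro projected_curve_eq_UNIV) blast
  obtain D h1 h2 x0 where x0: "x0 \<in> C" "peval D (proj12 x0) \<noteq> 0"
    and h2: "\<And>y. peval D y \<noteq> 0 \<Longrightarrow> peval h2 y \<noteq> 0"
    and lift: "\<And>y. y \<in> projected_curve C \<Longrightarrow> peval D y \<noteq> 0 \<Longrightarrow>
      vector [y $ 1, y $ 2, peval h1 y / peval h2 y] \<in> C"
    using valid_projection_lift[OF val] by metis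
  \<comment> \<open>The line passes through the projection of \<open>x0\<close>, so \<open>D\<close>
    is not identically zero on it and vanishes there at finitely many points only.\<close>
  define c where "c = x0 $ 1"
  define line :: "complex \<Rightarrow> complex ^ 2" where "line y = vector [c, y]" for y
  define T where "T = {y. peval D (line y) \<noteq> 0}"
  define \<gamma> :: "complex \<Rightarrow> complex ^ 3" where
    "\<gamma> y = vector [c, y, peval h1 (line y) / peval h2 (line y)]" for y
  have line_poly: "\<exists>q. \<forall>y. peval p (line y) = poly q y" for p
  proof -
    obtain P where P: "\<And>a b. peval p (vector [a, b]) = eval2 P a b"
      using peval_eq_eval2 by blast
    have "\<exists>q. \<forall>y. eval2 P c y = poly q y"
    proof (induction P)
      case 0
      show ?case
        by (rule exI[of _ 0]) simp
    next
      case (pCons r P)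
      then obtain q where "\<forall>y. eval2 P c y = poly q y"
        by blast
      then show ?case
        by (intro exI[of _ "pCons (poly r c) q"]) simp
    qed
    then show ?thesis
      by (simp add: line_def P)
  qed
  obtain d where d: "\<And>y. peval D (line y) = poly d y"
    using line_poly by blast
  have "x0 $ 2 \<in> T"
    using x0 by (simp add: T_def line_def c_def proj12_def)
  then have "d \<noteq> 0"
    by (auto simp: T_def d)
  then have fin: "finite (- T)"
    using poly_roots_finite[of d] by (simp add: T_def d Compl_eq)
  then have "open T"
    using finite_imp_closed open_closed by blast
  have "connected (UNIV - (- T))"
    using fin by (intro connected_open_delete_finite) auto
  then have "connected T"
    by (simp add: Diff_eq)
  have "infinite T"
    using fin infinite_UNIV_char_0[where ?'a = complex] by (metis Compl_partition2 finite_Un)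
  \<comment> \<open>Holomorphy on the connected open set \<open>T\<close> lets the identity theorem
    show that the ideal of the lifted line is prime.\<close>
  have hol: "(\<lambda>y. peval p (\<gamma> y)) holomorphic_on T" for p
  proof -
    have *: "(\<lambda>y. peval q (line y)) holomorphic_on T" for q
    proof -
      obtain r where "\<And>y. peval q (line y) = poly r y"
        using line_poly by blast
      then show ?thesis
        by (auto intro: holomorphic_intros)
    qed
    show ?thesis
    proof (induction p rule: peval_induct)
      case (coord i)
      consider "i = 1" | "i = 2" | "i = 3"
        by (meson exhaust_3)
      then show ?case
        by cases (use h2 in \<open>auto simp: \<gamma>_def T_def intro!: holomorphic_intros *[unfolded T_def]\<close>)
    qed (auto intro: holomorphic_intros)
  qed
  define Z where "Z = zariski_closure (\<gamma> ` T)"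
  have "irreducible_variety Z"
    unfolding Z_def
  proof (rule irreducible_zariski_closure)
    show "\<gamma> ` T \<noteq> {}"
      using \<open>infinite T\<close> by auto
    fix p q assume "\<And>x. x \<in> \<gamma> ` T \<Longrightarrow> peval p x * peval q x = 0"
    then show "(\<forall>x\<in>\<gamma> ` T. peval p x = 0) \<or> (\<forall>x\<in>\<gamma> ` T. peval q x = 0)"
      using holomorphic_mult_eq_0[OF hol hol \<open>open T\<close> \<open>connected T\<close>, of p q] by auto
  qed
  moreover have "{\<gamma> (x0 $ 2)} \<subset> Z"
  proof -
    have "infinite (\<gamma> ` T)"
    proof
      assume "finite (\<gamma> ` T)"
      then have "finite ((\<lambda>x. x $ 2) ` \<gamma> ` T)"
        by blast
      then show False
        using \<open>infinite T\<close> by (simp add: image_image \<gamma>_def)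
    qed
    then have "\<gamma> ` T \<noteq> {\<gamma> (x0 $ 2)}"
      by (metis finite.emptyI finite_insert)
    then show ?thesis
      using subset_zariski_closure[of "\<gamma> ` T"] \<open>x0 $ 2 \<in> T\<close> unfolding Z_def by blast
  qed
  moreover have "Z \<subset> C"
  proof -
    have "\<gamma> ` T \<subseteq> C"
      using lift[of "line _"] by (auto simp: UNIV T_def \<gamma>_def line_def)
    then have "Z \<subseteq> C"
      unfolding Z_def using irr by (intro zariski_closure_minimal) (auto simp: irreducible_variety_def)
    \<comment> \<open>The lifted line, and with it its closure, lies in the plane where the first
      coordinate is \<open>c\<close>, while \<open>C\<close> is not planar.\<close>
    moreover have "Z \<noteq> C"
    proof
      assume "Z = C"
      have "polyfun (\<lambda>x :: complex ^ 3. x $ 1 + (- c))"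
        by (intro polyfun_add polyfun_coord polyfun_const)
      then obtain p where p: "\<And>x :: complex ^ 3. peval p x = x $ 1 - c"
        by (auto simp: polyfun_def)
      then have "p \<in> vanishing_ideal (\<gamma> ` T)"
        by (simp add: vanishing_ideal_def \<gamma>_def)
      then have "C \<subseteq> {x. 1 * x $ 1 + 0 * x $ 2 + 0 * x $ 3 = c}"
        using p unfolding \<open>Z = C\<close>[symmetric] Z_def by (auto simp: zariski_closure_def zero_set_def)
      then have "planar C"
        unfolding planar_def by (intro exI[of _ 1] exI[of _ 0] exI[of _ 0] exI[of _ c]) simp
      then show False
        using \<open>\<not> planar C\<close> by contradiction
    qed
    ultimately show ?thesis
      by blast
  qed
  ultimately have "zariski_dim C \<ge> 2"
    using zariski_dim_ge_2 irreducible_variety_singleton irr by blast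
  then show False
    by (simp add: dim one_enat_def numeral_eq_enat)
qed

section \<open>Puiseux series\<close>

text \<open>The local parameter w = z^(-1/n) at infinity, in the same principal branch as
  \<open>infinity_series\<close>, so that each term of a leaf is z times a power of w.\<close>

definition uniformizer :: "nat \<Rightarrow> complex \<Rightarrow> complex" where
  "uniformizer n z = z powr (- (1 / of_nat n))"

lemma uniformizer_power:
  assumes "z \<noteq> 0"
  shows "uniformizer n z ^ k = z powr (- (of_nat k / of_nat n))"
  using assms by (simp add: uniformizer_def powr_def exp_of_nat_mult[symmetric] mult_ac)

lemma uniformizer_power_self:
  assumes "z \<noteq> 0" "n > 0"
  shows "uniformizer n z ^ n = 1 / z"
  using assms by (simp add: uniformizer_power powr_minus divide_inverse)

text \<open>The modulus is |z|^(-1/n) whatever the argument of z. The punctured filter at 0 is the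
  one in which Laurent expansions are stated.\<close>

lemma filterlim_uniformizer:
  assumes "n > 0"
  shows "filterlim (uniformizer n) (at 0) at_infinity"
proof -
  have "((\<lambda>z. norm (uniformizer n z)) \<longlongrightarrow> 0) at_infinity"
  proof (rule Lim_transform_eventually)
    have "((\<lambda>x. x powr (- (1 / real n))) \<longlongrightarrow> 0) at_top"
      using assms by (intro tendsto_neg_powr filterlim_ident) auto
    then show "((\<lambda>z::complex. norm z powr (- (1 / real n))) \<longlongrightarrow> 0) at_infinity"
      by (rule filterlim_compose) (rule filterlim_norm_at_top)
    show "\<forall>\<^sub>F z in at_infinity. norm z powr (- (1 / real n)) = norm (uniformizer n z)"
      using eventually_not_equal_at_infinity[of 0]
    proof eventually_elim
      case (elim z)
      have "uniformizer n z = z powr of_real (- (1 / real n))"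
        by (simp add: uniformizer_def)
      then show ?case
        using norm_powr_real_powr'[of "of_real (- (1 / real n))" z] by simp
    qed
  qed
  then have "(uniformizer n \<longlongrightarrow> 0) at_infinity"
    by (rule tendsto_norm_zero_cancel)
  moreover have "\<forall>\<^sub>F z in at_infinity. uniformizer n z \<noteq> 0"
    using eventually_not_equal_at_infinity[of 0] by eventually_elim (simp add: uniformizer_def)
  ultimately show ?thesis
    by (simp add: filterlim_at)
qed

lemma fls_root_no_negative_exponents:
  assumes "no_negative_exponents (fls_root n F)" "n > 0"
  shows "F = fps_to_fls (fls_regpart F)"
proof (rule fls_eqI)
  fix k :: int
  have "fls_nth F k = 0" if "k < 0"
  proof -
    have "fls_root n F (of_int k / of_nat n) = 0"
      using assms that by (auto simp: no_negative_exponents_def field_simps)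
    then show ?thesis
      using assms(2) by (simp add: fls_root_def)
  qed
  then show "fls_nth F k = fls_nth (fps_to_fls (fls_regpart F)) k"
    by (cases "k < 0") auto
qed

lemma no_negative_exponents_fps:
  "n > 0 \<Longrightarrow> no_negative_exponents (fls_root n (fps_to_fls G))"
  by (auto simp: no_negative_exponents_def fls_root_def floor_less_iff mult_less_0_iff)

text \<open>All exponents with a nonzero coefficient are of the form k/n with k natural; reindexing
  by k turns the unordered sum over the rationals into a power series in the uniformizer.\<close>

lemma has_sum_puiseux_iff:
  assumes "z \<noteq> 0" "n > 0"
  shows "((\<lambda>q. fls_root n (fps_to_fls G) q * z powr (1 - of_rat q)) has_sum S) UNIV \<longleftrightarrow>
         ((\<lambda>k. z * (fps_nth G k * uniformizer n z ^ k)) has_sum S) UNIV"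
    (is "(?f has_sum S) UNIV \<longleftrightarrow> _")
proof -
  let ?h = "\<lambda>k::nat. of_nat k / of_nat n :: rat"
  have "inj ?h"
    using assms(2) by (auto simp: inj_on_def)
  have "(?f has_sum S) UNIV \<longleftrightarrow> (?f has_sum S) (range ?h)"
  proof (rule has_sum_cong_neutral)
    fix q assume q: "q \<in> UNIV - range ?h"
    have "fls_root n (fps_to_fls G) q = 0"
    proof (cases "q * of_nat n \<in> \<int>")
      case True
      then obtain k where k: "q * of_nat n = of_int k"
        by (auto elim: Ints_cases)
      then have "q = of_int k / of_nat n"
        using assms(2) by (simp add: field_simps)
      have "k < 0"
      proof (rule ccontr)
        assume "\<not> k < 0"
        then have "q = ?h (nat k)"
          using \<open>q = of_int k / of_nat n\<close> by simp
        then show False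
          using q by blast
      qed
      then show ?thesis
        by (simp add: fls_root_def k)
    qed (simp add: fls_root_def)
    then show "?f q = 0"
      by simp
  qed auto
  also have "\<dots> \<longleftrightarrow> (?f \<circ> ?h has_sum S) UNIV"
    by (rule has_sum_reindex[OF \<open>inj ?h\<close>])
  also have "?f \<circ> ?h = (\<lambda>k. z * (fps_nth G k * uniformizer n z ^ k))"
  proof
    fix k
    have "z powr (1 - of_nat k / of_nat n) = z * uniformizer n z ^ k"
      using assms(1) by (simp add: uniformizer_power powr_diff powr_minus divide_inverse)
    then show "(?f \<circ> ?h) k = z * (fps_nth G k * uniformizer n z ^ k)"
      using assms(2) by (simp add: fls_root_def of_rat_divide)
  qed
  finally show ?thesis .
qed

lemma has_sum_puiseux:
  assumes "z \<noteq> 0" "n > 0" "norm (uniformizer n z) < fps_conv_radius G"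
  shows "((\<lambda>q. fls_root n (fps_to_fls G) q * z powr (1 - of_rat q)) has_sum
          z * eval_fps G (uniformizer n z)) UNIV"
  unfolding has_sum_puiseux_iff[OF assms(1,2)]
  by (intro has_sum_cmult_right norm_summable_imp_has_sum norm_summable_fps sums_eval_fps assms)

lemma converges_beyond_imp_conv_radius_pos:
  assumes "converges_beyond (fls_root n (fps_to_fls G)) M" "n > 0"
  shows "fps_conv_radius G > 0"
proof -
  \<comment> \<open>A sample point beyond \<open>M\<close> that is nonzero even for negative
    \<open>M\<close>. Convergence at its nonzero uniformizer bounds the radius from below.\<close>
  define z :: complex where "z = of_real (max M 0 + 1)"
  have z: "norm z > M" "z \<noteq> 0"
    unfolding z_def by (simp_all add: norm_of_real del: of_real_add)
  then obtain S where
    "((\<lambda>q. fls_root n (fps_to_fls G) q * z powr (1 - of_rat q)) has_sum S) UNIV"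
    using assms(1) by (auto simp: converges_beyond_def summable_on_def)
  then have "summable (\<lambda>k. z * (fps_nth G k * uniformizer n z ^ k))"
    using has_sum_puiseux_iff[OF z(2) assms(2)] has_sum_imp_sums sums_summable by blast
  then have "summable (\<lambda>k. fps_nth G k * uniformizer n z ^ k)"
    using z(2) by simp
  then have "fps_conv_radius G \<ge> norm (uniformizer n z)"
    unfolding fps_conv_radius_def by (rule conv_radius_geI)
  moreover have "ereal (norm (uniformizer n z)) > 0"
    using z(2) by (simp add: uniformizer_def)
  ultimately show ?thesis
    by (rule less_le_trans[rotated])
qed

section \<open>Laurent expansions along a leaf\<close>

lemma has_laurent_expansion_peval:
  fixes \<gamma> :: "complex \<Rightarrow> complex ^ 'n::finite"
  assumes "\<And>i. \<exists>G. (\<lambda>w. \<gamma> w $ i) has_laurent_expansion G"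
  shows "\<exists>G. (\<lambda>w. peval p (\<gamma> w)) has_laurent_expansion G"
proof (induction p rule: peval_induct)
  case (add f g)
  then obtain F G where "(\<lambda>w. f (\<gamma> w)) has_laurent_expansion F" "(\<lambda>w. g (\<gamma> w)) has_laurent_expansion G"
    by blast
  then show ?case
    by (intro exI[of _ "F + G"] has_laurent_expansion_add)
next
  case (mult f g)
  then obtain F G where "(\<lambda>w. f (\<gamma> w)) has_laurent_expansion F" "(\<lambda>w. g (\<gamma> w)) has_laurent_expansion G"
    by blast
  then show ?case
    by (intro exI[of _ "F * G"] has_laurent_expansion_mult)
qed (use assms in auto)

text \<open>The zeros of a function with a nonzero Laurent expansion do not accumulate at 0.\<close>

lemma has_laurent_expansion_frequently_zero:
  assumes "f has_laurent_expansion F" "\<exists>\<^sub>F w in at 0. f w = 0"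
  shows "\<forall>\<^sub>F w in at 0. f w = 0"
proof -
  have "F = 0"
    using assms has_laurent_expansion_eventually_nonzero_iff'[OF assms(1)] by (auto simp: frequently_def)
  then show ?thesis
    using assms(1) by (simp add: has_laurent_expansion_def eq_commute[of 0])
qed

text \<open>For n > 1 the principal branch reaches only a sector at 0, so truth near infinity gives
  frequent truth near 0. For functions with a Laurent expansion,
  \<open>has_laurent_expansion_frequently_zero\<close> then spreads vanishing to a full punctured
  neighbourhood.\<close>

lemma frequently_at_0_uniformizer:
  assumes "n > 0" "\<forall>\<^sub>F z in at_infinity. P (uniformizer n z)"
  shows "\<exists>\<^sub>F w in at 0. P w"
  unfolding frequently_def
proof
  assume "\<forall>\<^sub>F w in at 0. \<not> P w"
  then have "\<forall>\<^sub>F z in at_infinity. \<not> P (uniformizer n z)"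
    using filterlim_uniformizer[OF assms(1)] by (rule eventually_compose_filterlim)
  with assms(2) have "\<forall>\<^sub>F z :: complex in at_infinity. False"
    by eventually_elim auto
  then show False
    by (simp add: eventually_False trivial_limit_at_infinity)
qed

lemma eventually_norm_less_at_0:
  fixes r :: ereal
  assumes "r > 0"
  shows "\<forall>\<^sub>F w :: complex in at 0. norm w < r"
proof -
  have "\<forall>\<^sub>F w :: complex in at 0. w \<in> eball 0 r"
    using assms by (intro eventually_at_in_open') (auto simp: zero_ereal_def)
  then show ?thesis
    by eventually_elim simp
qed

section \<open>Lifting a leaf\<close>

text \<open>
  The coordinates of the leaf are Laurent series in \<open>w = z\<^bsup>-1/n\<^esup>\<close>. A polynomial in \<open>x\<^sub>1\<close> alone
  cannot vanish on it, so the prime ideal of the projected curve is already the full ideal of the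
  leaf.
\<close>

lemma infinity_branch_lift:
  fixes n :: nat and G :: "complex fps"
  defines "\<gamma> \<equiv> \<lambda>w. vector [1 / w ^ n, eval_fps G w / w ^ n] :: complex ^ 2"
  assumes irr: "irreducible_variety C" and dim: "zariski_dim C = 1" and "\<not> planar C"
    and val: "valid_projection_direction C" and n: "n > 0" and G: "fps_conv_radius G > 0"
    and leaf: "\<forall>\<^sub>F z in at_infinity. \<gamma> (uniformizer n z) \<in> projected_curve C"
  obtains f F where "f has_laurent_expansion F"
    "\<forall>\<^sub>F z in at_infinity. vector [z, z * eval_fps G (uniformizer n z), z * f (uniformizer n z)] \<in> C"
proof -
  let ?u = "uniformizer n"
  have \<gamma>_laurent: "\<exists>H. (\<lambda>w. peval p (\<gamma> w)) has_laurent_expansion H" for p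
  proof (rule has_laurent_expansion_peval)
    fix i :: 2
    have "(\<lambda>w. 1 / w ^ n) has_laurent_expansion 1 / fls_X ^ n"
      by (intro laurent_expansion_intros)
    moreover have "(\<lambda>w. eval_fps G w / w ^ n) has_laurent_expansion fps_to_fls G / fls_X ^ n"
      using G by (intro laurent_expansion_intros has_laurent_expansion_fps eval_fps_has_fps_expansion)
    moreover have "i = 1 \<or> i = 2"
      by (rule exhaust_2)
    ultimately show "\<exists>H. (\<lambda>w. \<gamma> w $ i) has_laurent_expansion H"
      by (auto simp: \<gamma>_def)
  qed
  \<comment> \<open>The polynomial relations between the coordinates near w = 0, each on a punctured
    neighbourhood of its own.\<close>
  define I where "I = {P. \<forall>\<^sub>F w in at 0. eval2 P (\<gamma> w $ 1) (\<gamma> w $ 2) = 0}"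
  have \<gamma>_u: "\<gamma> (?u z) = vector [z, z * eval_fps G (?u z)]" if "z \<noteq> 0" for z
    using that n by (simp add: \<gamma>_def uniformizer_power_self mult.commute)
  have "I \<subseteq> proj_ideal C"
  proof (rule prime_ideal_maximal_over_constants)
    show "proj_ideal C \<subseteq> I"
    proof
      fix P assume P: "P \<in> proj_ideal C"
      have "polyfun (\<lambda>y :: complex ^ 2. eval2 P (y $ 1) (y $ 2))"
        by (intro polyfun_eval2 polyfun_coord)
      then obtain p where p: "\<And>y :: complex ^ 2. peval p y = eval2 P (y $ 1) (y $ 2)"
        by (auto simp: polyfun_def)
      obtain H where H: "(\<lambda>w. peval p (\<gamma> w)) has_laurent_expansion H"
        using \<gamma>_laurent by blast
      have "\<forall>\<^sub>F z in at_infinity. peval p (\<gamma> (?u z)) = 0"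
        using leaf by eventually_elim (simp add: p proj_ideal_projected_curve[OF P])
      then have "\<exists>\<^sub>F w in at 0. peval p (\<gamma> w) = 0"
        by (rule frequently_at_0_uniformizer[OF n])
      from has_laurent_expansion_frequently_zero[OF H this] show "P \<in> I"
        by (simp add: I_def p)
    qed
    show "\<exists>P\<in>proj_ideal C. P \<noteq> 0"
      by (rule proj_ideal_nonzero) fact+
    show "P * Q \<in> proj_ideal C" if "P \<in> proj_ideal C" for P Q
      using that by (simp add: proj_ideal_def)
    show "P \<in> proj_ideal C \<or> Q \<in> proj_ideal C" if "P * Q \<in> proj_ideal C" for P Q
      using that by (rule proj_ideal_prime[OF irr])
    show "P * Q \<in> I" if "P \<in> I" for P Q
      using that unfolding I_def mem_Collect_eq by eventually_elim simp
    show "P - Q \<in> I" if "P \<in> I" "Q \<in> I" for P Q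
      using that unfolding I_def mem_Collect_eq by eventually_elim simp
  next
    \<comment> \<open>Here \<open>a\<close> is a polynomial in the first coordinate, which is z on
      the leaf; it would vanish at all large z, too many roots for a nonzero polynomial.\<close>
    fix a assume "[:a:] \<in> I"
    then have "\<forall>\<^sub>F w in at 0. poly a (1 / w ^ n) = 0"
      by (simp add: I_def \<gamma>_def)
    then have "\<forall>\<^sub>F z in at_infinity. poly a (1 / ?u z ^ n) = 0"
      using filterlim_uniformizer[OF n] by (rule eventually_compose_filterlim)
    then have zero: "\<forall>\<^sub>F z in at_infinity. poly a z = 0"
      using eventually_not_equal_at_infinity[of 0]
      by eventually_elim (use n in \<open>simp add: uniformizer_power_self\<close>)
    show "a = 0"
    proof (rule ccontr)
      assume "a \<noteq> 0"
      then have "bounded {z. poly a z = 0}"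
        by (intro finite_imp_bounded poly_roots_finite)
      then obtain b where b: "\<And>z. poly a z = 0 \<Longrightarrow> norm z \<le> b"
        by (auto simp: bounded_iff)
      obtain b' where b': "\<And>z. norm z \<ge> b' \<Longrightarrow> poly a z = 0"
        using zero by (auto simp: eventually_at_infinity)
      define x where "x = \<bar>b\<bar> + \<bar>b'\<bar> + 1"
      have "norm (complex_of_real x) = \<bar>b\<bar> + \<bar>b'\<bar> + 1"
        unfolding norm_of_real by (simp add: x_def)
      then show False
        using b[of "of_real x"] b'[of "of_real x"] by linarith
    qed
  qed
  obtain D h1 h2 x0 where x0: "x0 \<in> C" "peval D (proj12 x0) \<noteq> 0"
    and h2: "\<And>y. peval D y \<noteq> 0 \<Longrightarrow> peval h2 y \<noteq> 0"
    and lift: "\<And>y. y \<in> projected_curve C \<Longrightarrow> peval D y \<noteq> 0 \<Longrightarrow>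
      vector [y $ 1, y $ 2, peval h1 y / peval h2 y] \<in> C"
    using valid_projection_lift[OF val] by metis
  obtain P where P: "\<And>a b. peval D (vector [a, b]) = eval2 P a b"
    using peval_eq_eval2 by blast
  \<comment> \<open>The lift is defined at \<open>x0\<close>, so \<open>D\<close> is not in the
    ideal of the projected curve, hence not in that of the leaf; as its zeros do not accumulate, it
    is nonzero near w = 0.\<close>
  have "P \<notin> proj_ideal C"
    using x0 by (auto simp: proj_ideal_def proj12_def P)
  then have "P \<notin> I"
    using \<open>I \<subseteq> proj_ideal C\<close> by blast
  moreover have "eval2 P (y $ 1) (y $ 2) = peval D y" for y
    by (simp add: P[symmetric] vector_2_eta)
  ultimately have "\<not> (\<forall>\<^sub>F w in at 0. peval D (\<gamma> w) = 0)"
    by (simp add: I_def)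
  moreover obtain H where "(\<lambda>w. peval D (\<gamma> w)) has_laurent_expansion H"
    using \<gamma>_laurent[of D] by (elim exE)
  note has_laurent_expansion_frequently_zero[OF this]
  ultimately have "\<not> (\<exists>\<^sub>F w in at 0. peval D (\<gamma> w) = 0)"
    by (elim contrapos_nn)
  then have "\<forall>\<^sub>F w in at 0. peval D (\<gamma> w) \<noteq> 0"
    by (simp add: not_frequently)
  then have D: "\<forall>\<^sub>F z in at_infinity. peval D (\<gamma> (?u z)) \<noteq> 0"
    using filterlim_uniformizer[OF n] by (rule eventually_compose_filterlim)
  \<comment> \<open>The factor \<open>w ^ n\<close> is 1/z on the leaf, so that z times
    \<open>f\<close> is the lift function and \<open>f\<close> provides the series \<phi>3.\<close>
  define f where "f w = w ^ n * (peval h1 (\<gamma> w) / peval h2 (\<gamma> w))" for w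
  obtain H1 H2 where H: "(\<lambda>w. peval h1 (\<gamma> w)) has_laurent_expansion H1"
      "(\<lambda>w. peval h2 (\<gamma> w)) has_laurent_expansion H2"
    using \<gamma>_laurent by blast
  show thesis
  proof (rule that)
    show "f has_laurent_expansion fls_X ^ n * (H1 / H2)"
      unfolding f_def[abs_def]
      by (intro has_laurent_expansion_mult has_laurent_expansion_divide has_laurent_expansion_power
          has_laurent_expansion_fps_X H)
    show "\<forall>\<^sub>F z in at_infinity. vector [z, z * eval_fps G (?u z), z * f (?u z)] \<in> C"
      using leaf D eventually_not_equal_at_infinity[of 0]
    proof eventually_elim
      case (elim z)
      then have "z * f (?u z) = peval h1 (\<gamma> (?u z)) / peval h2 (\<gamma> (?u z))"
        using n by (simp add: f_def uniformizer_power_self)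
      then show ?case
        using lift[OF elim(1,2)] elim(3) by (simp add: \<gamma>_u)
    qed
  qed
qed

text \<open>
  Since the first two coordinates are \<open>O(z)\<close>, a pole of \<open>f\<close> would make \<open>(0:0:1:0)\<close> a point at
  infinity.
\<close>

lemma infinity_branch_no_pole:
  fixes C :: "(complex ^ 3) set"
  assumes f: "f has_laurent_expansion F" and n: "n > 0" and G: "fps_conv_radius G > 0"
    and C: "\<forall>\<^sub>F z in at_infinity.
      vector [z, z * eval_fps G (uniformizer n z), z * f (uniformizer n z)] \<in> C"
    and inf: "vector [0, 0, 1] \<notin> points_at_infinity C"
  shows "fls_subdegree F \<ge> 0"
proof (rule ccontr)
  let ?u = "uniformizer n"
  assume "\<not> fls_subdegree F \<ge> 0"
  then have "filterlim f at_infinity (at 0)"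
    using f by (intro has_laurent_expansion_imp_filterlim_infinity_0) auto
  then have f_inf: "filterlim (\<lambda>z. f (?u z)) at_infinity at_infinity"
    using filterlim_uniformizer[OF n] by (rule filterlim_compose)
  then have inv_f: "((\<lambda>z. inverse (f (?u z))) \<longlongrightarrow> 0) at_infinity"
    by (rule filterlim_compose[OF tendsto_inverse_0])
  have "(eval_fps G \<longlongrightarrow> fps_nth G 0) (at 0)"
    using has_fps_expansion_imp_tendsto_0[OF eval_fps_has_fps_expansion[OF G]]
    by (simp add: tendsto_nhds_iff)
  then have g: "((\<lambda>z. eval_fps G (?u z)) \<longlongrightarrow> fps_nth G 0) at_infinity"
    using filterlim_uniformizer[OF n] by (rule filterlim_compose)
  \<comment> \<open>This scaling turns the third coordinate into 1 and the first two into 1/f and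
    g/f, which tend to 0 because g = \<open>eval_fps G\<close> has a finite limit at 0.\<close>
  define s where "s z = inverse z * inverse (f (?u z))" for z
  define x :: "complex \<Rightarrow> complex ^ 3" where
    "x z = vector [z, z * eval_fps G (?u z), z * f (?u z)]" for z
  have f_nz: "\<forall>\<^sub>F z in at_infinity. f (?u z) \<noteq> 0"
    using f_inf by (rule filterlim_at_infinity_imp_eventually_ne)
  have "vector [0, 0, 1] \<in> points_at_infinity C"
  proof (rule points_at_infinityI)
    show "(at_infinity :: complex filter) \<noteq> bot"
      by (rule trivial_limit_at_infinity)
    have "((\<lambda>z. inverse z) \<longlongrightarrow> (0 :: complex)) at_infinity"
      by (rule tendsto_inverse_0)
    from tendsto_mult[OF this inv_f] show "(s \<longlongrightarrow> 0) at_infinity"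
      by (simp add: s_def[abs_def])
    show "\<forall>\<^sub>F z in at_infinity. s z \<noteq> 0 \<and> x z \<in> C"
      using C f_nz eventually_not_equal_at_infinity[of 0]
      by eventually_elim (simp add: s_def x_def)
    show "((\<lambda>z. s z *s x z) \<longlongrightarrow> vector [0, 0, 1]) at_infinity"
    proof (rule Lim_transform_eventually)
      show "((\<lambda>z. vector [inverse (f (?u z)), eval_fps G (?u z) * inverse (f (?u z)), 1] :: complex ^ 3)
          \<longlongrightarrow> vector [0, 0, 1]) at_infinity"
      proof (rule vec_tendstoI)
        fix i :: 3
        show "((\<lambda>z. (vector [inverse (f (?u z)), eval_fps G (?u z) * inverse (f (?u z)), 1]
            :: complex ^ 3) $ i) \<longlongrightarrow> vector [0, 0, 1] $ i) at_infinity"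
          using inv_f tendsto_mult[OF g inv_f] exhaust_3[of i] by auto
      qed
      show "\<forall>\<^sub>F z in at_infinity.
          vector [inverse (f (?u z)), eval_fps G (?u z) * inverse (f (?u z)), 1] = s z *s x z"
        using f_nz eventually_not_equal_at_infinity[of 0]
      proof eventually_elim
        case (elim z)
        then have "s z * z = inverse (f (?u z))" "s z * (z * f (?u z)) = 1"
          by (simp_all add: s_def field_simps)
        then show ?case
          by (simp add: x_def vec_eq_iff forall_3 mult.assoc[symmetric] mult.commute[of "eval_fps _ _"])
      qed
    qed
    show "(vector [0, 0, 1] :: complex ^ 3) \<noteq> 0"
      by (metis vector_3(3) zero_index zero_neq_one)
  qed
  with inf show False
    by contradiction
qed

section \<open>Equivalence of plane and space infinity branches\<close>

theorem theorem3p1: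
  fixes f1 f2 :: "3 cpoly" and C :: "(complex ^ 3) set" and \<phi>2 :: "rat \<Rightarrow> complex"
  assumes "real_coeffs f1" and "real_coeffs f2"
    and "C = zero_set {f1, f2}"
    and "zariski_dim C = 1"
    and "irreducible_variety C"
    and "infinite (real_points C)"
    and "\<not> planar C"
    and "\<forall>x\<in>points_at_infinity C. \<exists>k m2 m3. k \<noteq> 0 \<and> x = k *s vector [1, m2, m3]"
    and "valid_projection_direction C"
  shows "(\<exists>Mp>0. \<exists>Bp. plane_infinity_branch (projected_curve C) Bp \<phi>2 Mp) \<longleftrightarrow>
         (\<exists>\<phi>3\<in>puiseux_series. \<exists>M>0. \<exists>B. space_infinity_branch C B \<phi>2 \<phi>3 M)"
proof
  assume "\<exists>\<phi>3\<in>puiseux_series. \<exists>M>0. \<exists>B. space_infinity_branch C B \<phi>2 \<phi>3 M"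
  then obtain \<phi>3 M where M: "M > 0" "admissible_series \<phi>2 M" "space_leaf \<phi>2 \<phi>3 M \<subseteq> C"
    by (auto simp: space_infinity_branch_def)
  have "vector [z, infinity_series \<phi>2 z] \<in> projected_curve C" if "norm z > M" for z
  proof -
    have "proj12 (vector [z, infinity_series \<phi>2 z, infinity_series \<phi>3 z]) \<in> proj12 ` C"
      using M(3) that by (auto simp: space_leaf_def)
    then show ?thesis
      using subset_zariski_closure[of "proj12 ` C"] by (auto simp: projected_curve_def proj12_def)
  qed
  then have "plane_leaf \<phi>2 M \<subseteq> projected_curve C"
    by (auto simp: plane_leaf_def)
  then show "\<exists>Mp>0. \<exists>Bp. plane_infinity_branch (projected_curve C) Bp \<phi>2 Mp"
    using M by (auto simp: plane_infinity_branch_def)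
next
  assume "\<exists>Mp>0. \<exists>Bp. plane_infinity_branch (projected_curve C) Bp \<phi>2 Mp"
  then obtain Mp where Mp: "Mp > 0" "admissible_series \<phi>2 Mp"
    and leaf: "plane_leaf \<phi>2 Mp \<subseteq> projected_curve C"
    by (auto simp: plane_infinity_branch_def)
  obtain n F where "n \<ge> 1" and F: "\<phi>2 = fls_root n F"
    using Mp(2) by (auto simp: admissible_series_def puiseux_series_def)
  then have n: "n > 0"
    by simp
  let ?u = "uniformizer n"
  \<comment> \<open>Without negative exponents the Laurent series is a power series, which can be
    evaluated at the uniformizer.\<close>
  define G where "G = fls_regpart F"
  have \<phi>2: "\<phi>2 = fls_root n (fps_to_fls G)"
    using Mp(2) fls_root_no_negative_exponents[of n F] n F by (simp add: admissible_series_def G_def)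
  have G: "fps_conv_radius G > 0"
    using Mp(2) n by (intro converges_beyond_imp_conv_radius_pos) (auto simp: admissible_series_def \<phi>2)
  have G_radius: "\<forall>\<^sub>F z in at_infinity. norm (?u z) < fps_conv_radius G"
    using eventually_norm_less_at_0[OF G] filterlim_uniformizer[OF n]
    by (rule eventually_compose_filterlim)
  have r2: "\<forall>\<^sub>F z in at_infinity. infinity_series \<phi>2 z = z * eval_fps G (?u z)"
    using G_radius eventually_not_equal_at_infinity[of 0]
    by eventually_elim (auto simp: infinity_series_def \<phi>2 intro!: infsumI has_sum_puiseux n)
  have beyond: "\<forall>\<^sub>F z :: complex in at_infinity. norm z > Mp"
    by (auto simp: eventually_at_infinity intro!: exI[of _ "Mp + 1"])
  have "\<forall>\<^sub>F z in at_infinity.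
      vector [1 / ?u z ^ n, eval_fps G (?u z) / ?u z ^ n] \<in> projected_curve C"
    using r2 beyond eventually_not_equal_at_infinity[of 0]
  proof eventually_elim
    case (elim z)
    then have "vector [z, z * eval_fps G (?u z)] \<in> plane_leaf \<phi>2 Mp"
      by (force simp: plane_leaf_def)
    then show ?case
      using leaf elim n by (auto simp: uniformizer_power_self mult.commute)
  qed
  then obtain f F3 where f: "f has_laurent_expansion F3"
    and lift: "\<forall>\<^sub>F z in at_infinity. vector [z, z * eval_fps G (?u z), z * f (?u z)] \<in> C"
    by (rule infinity_branch_lift[OF assms(5,4,7,9) n G])
  \<comment> \<open>Every point at infinity has a nonzero first coordinate \<open>k\<close>.\<close>
  have "vector [0, 0, 1] \<notin> points_at_infinity C"
    using assms(8) by (fastforce simp: vec_eq_iff forall_3)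
  then have "fls_subdegree F3 \<ge> 0"
    by (rule infinity_branch_no_pole[OF f n G lift])
  define G3 where "G3 = fls_regpart F3"
  have F3: "F3 = fps_to_fls G3"
    using \<open>fls_subdegree F3 \<ge> 0\<close> by (simp add: G3_def)
  \<comment> \<open>The lift function is rational in z and r_2(z), so its expansion needs no finer
    roots of z, and the denominator \<open>n\<close> of \<phi>2 serves again.\<close>
  define \<phi>3 where "\<phi>3 = fls_root n (fps_to_fls G3)"
  have G3: "fps_conv_radius G3 > 0" and f_eq: "\<forall>\<^sub>F w in at 0. eval_fls (fps_to_fls G3) w = f w"
    using f by (simp_all add: has_laurent_expansion_def F3)
  have "\<forall>\<^sub>F w in at 0. norm w < fps_conv_radius G3 \<and> eval_fps G3 w = f w"
    using f_eq eventually_norm_less_at_0[OF G3] by eventually_elim (simp add: eval_fps_to_fls)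
  then have "\<forall>\<^sub>F z in at_infinity. norm (?u z) < fps_conv_radius G3 \<and> eval_fps G3 (?u z) = f (?u z)"
    using filterlim_uniformizer[OF n] by (rule eventually_compose_filterlim)
  then have "\<forall>\<^sub>F z in at_infinity. norm (?u z) < fps_conv_radius G3 \<and>
      vector [z, infinity_series \<phi>2 z, infinity_series \<phi>3 z] \<in> C"
    using lift r2 eventually_not_equal_at_infinity[of 0]
  proof eventually_elim
    case (elim z)
    then have "infinity_series \<phi>3 z = z * f (?u z)"
      using has_sum_puiseux[of z n G3] n by (simp add: infinity_series_def \<phi>3_def infsumI)
    then show ?case
      using elim by simp
  qed
  then obtain b where b: "\<And>z. norm z \<ge> b \<Longrightarrow> norm (?u z) < fps_conv_radius G3 \<and>
      vector [z, infinity_series \<phi>2 z, infinity_series \<phi>3 z] \<in> C"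
    by (auto simp: eventually_at_infinity)
  \<comment> \<open>Beyond \<open>b\<close> the third series converges and the lifted points lie on
    \<open>C\<close>; beyond \<open>Mp\<close> the series \<phi>2 converges, and \<open>Mp\<close>
    also makes \<open>M\<close> positive.\<close>
  define M where "M = max b Mp"
  have "M > 0"
    using Mp by (simp add: M_def)
  have puiseux: "\<phi>3 \<in> puiseux_series"
    unfolding puiseux_series_def \<phi>3_def using \<open>n \<ge> 1\<close> by blast
  have "converges_beyond \<phi>3 M"
    unfolding converges_beyond_def \<phi>3_def
  proof (intro allI impI)
    fix z :: complex assume "norm z > M"
    then have "z \<noteq> 0" "norm (?u z) < fps_conv_radius G3"
      using b[of z] Mp by (auto simp: M_def)
    then show "(\<lambda>q. fls_root n (fps_to_fls G3) q * z powr (1 - of_rat q)) summable_on UNIV"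
      using has_sum_puiseux n by (auto simp: summable_on_def)
  qed
  then have "admissible_series \<phi>3 M"
    using puiseux n by (simp add: admissible_series_def \<phi>3_def no_negative_exponents_fps)
  moreover have "admissible_series \<phi>2 M"
    using Mp by (auto simp: admissible_series_def converges_beyond_def M_def)
  moreover have "space_leaf \<phi>2 \<phi>3 M \<subseteq> C"
    using b by (auto simp: space_leaf_def M_def)
  \<comment> \<open>The conjugates are determined by the leaf, so their union serves as the
    branch.\<close>
  ultimately have "space_infinity_branch C (space_branch \<phi>2 \<phi>3 M) \<phi>2 \<phi>3 M"
    by (simp add: space_infinity_branch_def)
  then show "\<exists>\<phi>3\<in>puiseux_series. \<exists>M>0. \<exists>B. space_infinity_branch C B \<phi>2 \<phi>3 M"
    using puiseux \<open>M > 0\<close> by blast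
qed

end
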